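(* Let $n$ be a positive integer, let $k\geq 2$ be an integer, let $g:V(P_n)\to\{1,\ldots,k\}$ be a surjective $k$-coloring, and let $t=\mathrm{type}(g)=(n_1,\ldots,n_k)$. The following are equivalent. (1) $g$ is a $k$-color weak maximizer of $W$ on $P_n$. (2) $g$ is a $k$-color local weak maximizer of $W$ on $P_n$. (3) $g\in\mathcal{C}_t$.
   Context: $P_n$ is the path with vertex set $\{1,\ldots,n\}$, consecutive integers being adjacent. For a finite simple connected graph $G$ and $A\subseteq V(G)$, $W(A)=\sum_{\{u,v\}\in\binom{A}{2}}d_G(u,v)$, with $d_G$ the shortest-path distance. A $k$-coloring of $G$ is any function $f:V(G)\to\{1,\ldots,k\}$; $\mathrm{type}(f)$ is the $k$-tuple of the cardinalities $|f^{-1}(1)|,\ldots,|f^{-1}(k)|$ arranged in non-decreasing order, and $W(f)=\sum_{i=1}^k W(f^{-1}(i))$. For $u,v\in V(G)$, $S_{u,v}(f)$ is the coloring obtained from $f$ by swapping the colors of $u$ and $v$. For $k\geq 2$: $f$ is a $k$-color local weak maximizer of $W$ on $G$ if $f$ is surjective and $W(f)\geq W(S_{u,v}(f))$ for all edges $\{u,v\}\in E(G)$; $f$ is a $k$-color weak maximizer of $W$ on $G$ if $f$ is surjective and $W(f)\geq W(f')$ for all surjective $f':V(G)\to\{1,\ldots,k\}$ with $\mathrm{type}(f')=\mathrm{type}(f)$. Definition of $\mathcal{C}_t$. Let $t=(n_1,\ldots,n_k)$ be positive integers with $n_1\leq\cdots\leq n_k$ and $n_1+\cdots+n_k=n$.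 For a tuple $x=(x_1,\ldots,x_k)$ let $M(x)=\{i : 1\leq i\leq k,\ x_i=\max_{1\leq j\leq k}x_j\}$. Define $k$-tuples $r^1,r^2,\ldots$ by $r^1=t$ and: if $\max(r^i)>1$, then $r^{i+1}_j=r^i_j-2$ for $j\in M(r^i)$ and $r^{i+1}_j=r^i_j$ otherwise; if $\max(r^i)=1$, then $r^{i+1}_j=r^i_j-1$ for $j\in M(r^i)$ and $r^{i+1}_j=r^i_j$ otherwise. Let $i^*$ be the greatest positive integer $i$ with $\max(r^i)>0$, and for $1\leq i\leq i^*$ let $m_i=|M(r^i)|$. For $1\leq i\leq i^*$ let (integer intervals, empty sums being $0$) $$D_i^L=[1+m_1+\cdots+m_{i-1},\ m_1+\cdots+m_i],\qquad D_i^R=[n-(m_1+\cdots+m_i)+1,\ n-(m_1+\cdots+m_{i-1})].$$ Then $\mathcal{C}_t$ is the family of functions $f:V(P_n)\to\{1,\ldots,k\}$ such that: if $\max(r^{i^*})>1$, then for all $1\leq i\leq i^*$ both restrictions $f\restriction D_i^L:D_i^L\to M(r^i)$ and $f\restriction D_i^R:D_i^R\to M(r^i)$ are bijections; if $\max(r^{i^*})=1$, then for all $1\leq i<i^*$ both of these restrictions are bijections onto $M(r^i)$, and $f\restriction D_{i^*}^L:D_{i^*}^L\to M(r^{i^*})$ is a bijection.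
   Formalization: (3) fails literally if color classes are not in non-decreasing size order (n=3, k=2, g=(1,2,1)); it is read as: some permutation of the colors carries g into C_t, and as g in C_t itself when |g^{-1}(i)|=n_i for all i. *)

theory Defs
  imports Main "HOL-Library.FuncSet" "HOL-Combinatorics.Permutations"
begin

section \<open>Simple graphs and the Wiener index\<close>

text \<open>A simple graph is a vertex set together with a set of two-element edges.\<close>

type_synonym 'a sgraph = "'a set \<times> 'a set set"

definition verts :: "'a sgraph \<Rightarrow> 'a set" where
  "verts G = fst G"

definition edges :: "'a sgraph \<Rightarrow> 'a set set" where
  "edges G = snd G"

definition path_graph :: "nat \<Rightarrow> nat sgraph" where
  "path_graph n = ({1..n}, {{u, v} | u v. u \<in> {1..n} \<and> v \<in> {1..n} \<and> v = u + 1})"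

definition is_path :: "'a sgraph \<Rightarrow> 'a \<Rightarrow> 'a list \<Rightarrow> 'a \<Rightarrow> bool" where
  "is_path G u p v \<longleftrightarrow>
     p \<noteq> [] \<and> hd p = u \<and> last p = v \<and> distinct p \<and> set p \<subseteq> verts G \<and>
     (\<forall>i. Suc i < length p \<longrightarrow> {p ! i, p ! Suc i} \<in> edges G)"

text \<open>The length of a path is its number of edges. The value is only meaningful when
  \<open>u\<close> and \<open>v\<close> lie in the same component.\<close>

definition gdist :: "'a sgraph \<Rightarrow> 'a \<Rightarrow> 'a \<Rightarrow> nat" where
  "gdist G u v = (LEAST l. \<exists>p. is_path G u p v \<and> l = length p - 1)"

text \<open>Each two-element subset \<open>{u, v}\<close> of \<open>A\<close> is represented by the ordered pair with
  \<open>u < v\<close>, so that it is counted exactly once.\<close>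

definition wiener_set :: "'a::linorder sgraph \<Rightarrow> 'a set \<Rightarrow> nat" where
  "wiener_set G A = (\<Sum>(u, v) \<in> {(u, v). u \<in> A \<and> v \<in> A \<and> u < v}. gdist G u v)"


section \<open>Colorings\<close>

text \<open>A coloring is a function on the whole vertex type of which only the values on
  \<open>verts G\<close> are ever used.\<close>

definition color_class :: "'a sgraph \<Rightarrow> ('a \<Rightarrow> nat) \<Rightarrow> nat \<Rightarrow> 'a set" where
  "color_class G f i = {v \<in> verts G. f v = i}"

definition surj_coloring :: "'a sgraph \<Rightarrow> nat \<Rightarrow> ('a \<Rightarrow> nat) \<Rightarrow> bool" where
  "surj_coloring G k f \<longleftrightarrow> f ` verts G = {1..k}"

definition color_type :: "'a sgraph \<Rightarrow> nat \<Rightarrow> ('a \<Rightarrow> nat) \<Rightarrow> nat list" where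
  "color_type G k f = sort (map (\<lambda>i. card (color_class G f i)) [1..<k + 1])"

definition wiener :: "'a::linorder sgraph \<Rightarrow> nat \<Rightarrow> ('a \<Rightarrow> nat) \<Rightarrow> nat" where
  "wiener G k f = (\<Sum>i = 1..k. wiener_set G (color_class G f i))"

definition swap_colors :: "'a \<Rightarrow> 'a \<Rightarrow> ('a \<Rightarrow> nat) \<Rightarrow> 'a \<Rightarrow> nat" where
  "swap_colors u v f = f(u := f v, v := f u)"

definition local_weak_maximizer :: "'a::linorder sgraph \<Rightarrow> nat \<Rightarrow> ('a \<Rightarrow> nat) \<Rightarrow> bool" where
  "local_weak_maximizer G k f \<longleftrightarrow>
     surj_coloring G k f \<and>
     (\<forall>u v. {u, v} \<in> edges G \<longrightarrow> wiener G k f \<ge> wiener G k (swap_colors u v f))"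

definition weak_maximizer :: "'a::linorder sgraph \<Rightarrow> nat \<Rightarrow> ('a \<Rightarrow> nat) \<Rightarrow> bool" where
  "weak_maximizer G k f \<longleftrightarrow>
     surj_coloring G k f \<and>
     (\<forall>f'. surj_coloring G k f' \<and> color_type G k f' = color_type G k f
        \<longrightarrow> wiener G k f \<ge> wiener G k f')"


section \<open>The family of colorings attached to a type\<close>

text \<open>A \<open>k\<close>-tuple is a function whose values at \<open>1, \<dots>, k\<close> are its entries.\<close>

definition max_val :: "nat \<Rightarrow> (nat \<Rightarrow> nat) \<Rightarrow> nat" where
  "max_val k x = Max (x ` {1..k})"

definition max_set :: "nat \<Rightarrow> (nat \<Rightarrow> nat) \<Rightarrow> nat set" where
  "max_set k x = {i \<in> {1..k}. x i = max_val k x}"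

text \<open>Once all entries are \<open>0\<close> the truncated subtraction leaves the tuple unchanged; these
  further terms of the sequence \<open>residual\<close> below play no role.\<close>

definition peel :: "nat \<Rightarrow> (nat \<Rightarrow> nat) \<Rightarrow> nat \<Rightarrow> nat" where
  "peel k x = (\<lambda>j. if j \<in> max_set k x
                   then (if max_val k x > 1 then x j - 2 else x j - 1)
                   else x j)"

text \<open>\<open>residual t i\<close> is the tuple \<open>r\<^sup>i\<close>, for \<open>i \<ge> 1\<close>. The type \<open>t\<close> is a list, so its
  \<open>j\<close>-th entry \<open>n\<^sub>j\<close> is \<open>t ! (j - 1)\<close>.\<close>

definition residual :: "nat list \<Rightarrow> nat \<Rightarrow> nat \<Rightarrow> nat" where
  "residual t i = (peel (length t) ^^ (i - 1)) (\<lambda>j. t ! (j - 1))"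

definition res_max :: "nat list \<Rightarrow> nat \<Rightarrow> nat" where
  "res_max t i = max_val (length t) (residual t i)"

definition res_set :: "nat list \<Rightarrow> nat \<Rightarrow> nat set" where
  "res_set t i = max_set (length t) (residual t i)"

definition last_index :: "nat list \<Rightarrow> nat" where
  "last_index t = (GREATEST i. i \<ge> 1 \<and> res_max t i > 0)"

definition left_block :: "nat list \<Rightarrow> nat \<Rightarrow> nat set" where
  "left_block t i =
     {1 + (\<Sum>j = 1..<i. card (res_set t j)) .. (\<Sum>j = 1..i. card (res_set t j))}"

definition right_block :: "nat list \<Rightarrow> nat \<Rightarrow> nat set" where
  "right_block t i =
     {sum_list t - (\<Sum>j = 1..i. card (res_set t j)) + 1 ..
      sum_list t - (\<Sum>j = 1..<i. card (res_set t j))}"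

definition C_family :: "nat list \<Rightarrow> (nat \<Rightarrow> nat) set" where
  "C_family t = {f \<in> verts (path_graph (sum_list t)) \<rightarrow> {1..length t}.
     (res_max t (last_index t) > 1 \<longrightarrow>
        (\<forall>i \<in> {1..last_index t}.
           bij_betw f (left_block t i) (res_set t i) \<and>
           bij_betw f (right_block t i) (res_set t i))) \<and>
     (res_max t (last_index t) = 1 \<longrightarrow>
        (\<forall>i \<in> {1..<last_index t}.
           bij_betw f (left_block t i) (res_set t i) \<and>
           bij_betw f (right_block t i) (res_set t i)) \<and>
        bij_betw f (left_block t (last_index t)) (res_set t (last_index t)))}"

end

theory Submission
  imports Defs
begin

text \<open>For a vertex \<open>v\<close> of a colored path, let \<open>s(v)\<close>, called \<open>imbalance\<close> below, be the number of
  vertices of the color of \<open>v\<close> to the left of \<open>v\<close> minus the number of those to its right. All three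
  conditions of the theorem say that \<open>s\<close> is nondecreasing along the path.

  In a sum of distances over a set of integers, the element \<open>v\<close> is added once for each smaller
  element and subtracted once for each larger one. Hence \<open>W(f) = (\<Sum>v. v * s(v))\<close>
  (\<open>wiener_path_graph\<close>).

  Swapping two adjacent vertices \<open>u\<close>, \<open>u + 1\<close> of different colors exchanges their two values of \<open>s\<close>
  and changes no other, so the swap lowers \<open>W\<close> by \<open>s(u + 1) - s(u)\<close> (\<open>wiener_swap\<close>). If the colors
  agree then \<open>s(u) < s(u + 1)\<close> anyway. So local maximality is monotonicity of \<open>s\<close>.

  A color class with \<open>c\<close> elements takes the values \<open>1 - c, 3 - c, \<dots>, c - 1\<close> of \<open>s\<close>, once each. The
  multiset of all values of \<open>s\<close> therefore depends only on the type of the coloring, and among the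
  arrangements of a multiset of numbers on \<open>1, \<dots>, n\<close> a nondecreasing one maximizes
  \<open>\<Sum>v. v * s(v)\<close> (\<open>sum_weighted_le_sorted\<close>). So a coloring with monotone \<open>s\<close> is a weak maximizer.
  Conversely swaps preserve the type, so a weak maximizer is a local one.

  For the family \<open>C_family t\<close>, let \<open>q\<close> be the largest class size. The least value of \<open>s\<close> is \<open>1 - q\<close>,
  the greatest is \<open>q - 1\<close>, and each of the two is taken once by every color of maximal class size and
  by no other color. If \<open>s\<close> is monotone, these two level sets are an initial and a final block of the
  path, which is the first condition in the definition of the family. Deleting both blocks removes,
  for each color, equally many vertices on either side of a remaining vertex, so \<open>s\<close> is unchanged
  on the rest, whose class sizes are the next tuple of the sequence \<open>residual t\<close>. For \<open>q = 1\<close> the two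
  level sets coincide and fill the path. Iterating this
  equivalence (\<open>sorted_coloring_peel_iff\<close>) identifies the family with the colorings that have
  class sizes \<open>t\<close> and monotone \<open>s\<close> (\<open>C_family_iff_sorted_coloring\<close>). Renaming the colors does not
  change \<open>s\<close>, which accounts for the permutation of colors.\<close>


section \<open>The imbalance of a vertex in its color class\<close>

definition imbalance :: "(nat \<Rightarrow> nat) \<Rightarrow> nat set \<Rightarrow> nat \<Rightarrow> int" where
  "imbalance f I v =
     int (card {w \<in> I. w < v \<and> f w = f v}) - int (card {w \<in> I. v < w \<and> f w = f v})"

text \<open>Once the class size is known, the number of smaller elements alone determines the imbalance; this
  makes it strictly increasing on each class.\<close>

lemma imbalance_eq_rank:
  assumes "finite I" "v \<in> I"
  shows "imbalance f I v
    = 2 * int (card {w \<in> I. w < v \<and> f w = f v}) + 1 - int (card {w \<in> I. f w = f v})"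
proof -
  have "{w \<in> I. f w = f v}
      = insert v ({w \<in> I. w < v \<and> f w = f v} \<union> {w \<in> I. v < w \<and> f w = f v})"
    using assms(2) by auto
  moreover have "card \<dots> = 1 + (card {w \<in> I. w < v \<and> f w = f v} + card {w \<in> I. v < w \<and> f w = f v})"
    using assms(1) by (subst card_insert_disjoint, simp_all, subst card_Un_disjoint) auto
  ultimately show ?thesis by (simp add: imbalance_def)
qed

lemma rank_less_of_less:
  fixes I :: "nat set"
  assumes "finite I" "u \<in> I" "u < v" "f u = f v"
  shows "card {w \<in> I. w < u \<and> f w = f u} < card {w \<in> I. w < v \<and> f w = f v}"
  using assms by (intro psubset_card_mono) auto

lemma imbalance_less_of_less:
  assumes "finite I" "u \<in> I" "v \<in> I" "u < v" "f u = f v"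
  shows "imbalance f I u < imbalance f I v"
  using rank_less_of_less[OF assms(1,2,4,5)] imbalance_eq_rank[OF assms(1,2), of f]
    imbalance_eq_rank[OF assms(1,3), of f] assms(5)
  by simp

text \<open>A class of \<open>c\<close> elements takes exactly the values \<open>1 - c, 3 - c, \<dots>, c - 1\<close>, once each. The rank
  within the class is injective into \<open>{..<c}\<close>, hence onto by counting, so every admissible value
  is reached.\<close>

lemma bij_betw_imbalance_level:
  assumes fin: "finite I" and f: "f \<in> I \<rightarrow> K"
    and r: "\<And>j. j \<in> K \<Longrightarrow> card {v \<in> I. f v = j} = r j"
  shows "bij_betw f {v \<in> I. imbalance f I v = p}
           {j \<in> K. \<bar>p\<bar> < int (r j) \<and> even (int (r j) - 1 - p)}"
    (is "bij_betw f ?S ?T")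
proof (rule bij_betw_imageI)
  show "inj_on f ?S"
  proof (rule inj_onI)
    fix u v assume "u \<in> ?S" "v \<in> ?S" "f u = f v"
    then show "u = v"
      using imbalance_less_of_less[OF fin, of u v f] imbalance_less_of_less[OF fin, of v u f]
      by (cases u v rule: linorder_cases) auto
  qed
  show "f ` ?S = ?T"
  proof (intro subset_antisym subsetI)
    fix j assume "j \<in> f ` ?S"
    then obtain v where v: "v \<in> I" "imbalance f I v = p" "j = f v" by auto
    have jK: "j \<in> K" using v f by auto
    let ?b = "card {w \<in> I. w < v \<and> f w = f v}"
    have "?b < card {w \<in> I. f w = f v}"
      using v(1) fin by (intro psubset_card_mono) auto
    moreover have "p = 2 * int ?b + 1 - int (r j)"
      using imbalance_eq_rank[OF fin v(1), of f] v r[OF jK] by simp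
    ultimately show "j \<in> ?T" using jK r[OF jK] v(3) by auto
  next
    fix j assume j: "j \<in> ?T"
    define C where "C = {v \<in> I. f v = j}"
    define rank where "rank v = card {w \<in> I. w < v \<and> f w = f v}" for v
    have cC: "card C = r j" using r j by (auto simp: C_def)
    have finC: "finite C" using fin by (simp add: C_def)
    have inj: "inj_on rank C"
    proof (rule inj_onI)
      fix u v assume "u \<in> C" "v \<in> C" "rank u = rank v"
      then show "u = v"
        using rank_less_of_less[OF fin, of u v f] rank_less_of_less[OF fin, of v u f]
        by (cases u v rule: linorder_cases) (auto simp: C_def rank_def)
    qed
    have "rank ` C \<subseteq> {..<r j}"
    proof (intro image_subsetI)
      fix v assume v: "v \<in> C"
      have "rank v < card C"
        unfolding rank_def using v fin by (intro psubset_card_mono) (auto simp: C_def)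
      then show "rank v \<in> {..<r j}" using cC by simp
    qed
    moreover have "card (rank ` C) = card {..<r j}" using inj cC by (simp add: card_image)
    ultimately have surj: "rank ` C = {..<r j}" by (intro card_subset_eq) auto
    have bound: "\<bar>p\<bar> < int (r j)" and par: "even (int (r j) - 1 - p)" using j by blast+
    from par obtain c where c: "int (r j) - 1 - p = 2 * c" by (rule evenE)
    \<comment> \<open>the rank \<open>b\<close> is determined by \<open>p = 2 * b + 1 - r j\<close>, which gives \<open>b = c + p\<close>\<close>
    have range: "0 \<le> c + p" "c + p < int (r j)" using bound c by linarith+
    then have "nat (c + p) \<in> {..<r j}" by (simp add: nat_less_iff)
    then have "nat (c + p) \<in> rank ` C" using surj by simp
    then obtain v where v: "v \<in> C" "rank v = nat (c + p)" by (elim imageE) simp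
    have "imbalance f I v = 2 * int (rank v) + 1 - int (r j)"
      using imbalance_eq_rank[OF fin, of v f] v(1) cC by (auto simp: C_def rank_def)
    also have "\<dots> = p" using c range v(2) by linarith
    finally show "j \<in> f ` ?S" using v(1) by (intro image_eqI[of _ _ v]) (simp_all add: C_def)
  qed
qed

lemma abs_imbalance_less:
  assumes "finite I" "v \<in> I"
  shows "\<bar>imbalance f I v\<bar> < int (card {w \<in> I. f w = f v})"
proof -
  have "card {w \<in> I. w < v \<and> f w = f v} < card {w \<in> I. f w = f v}"
    using assms by (intro psubset_card_mono) auto
  then show ?thesis using imbalance_eq_rank[OF assms, of f] by linarith
qed


section \<open>Peeling off the extreme level sets\<close>

lemma down_closed_eq_interval:
  fixes S :: "nat set"
  assumes sub: "S \<subseteq> {A + 1..B}" and closed: "\<And>u v. v \<in> S \<Longrightarrow> u \<in> {A + 1..v} \<Longrightarrow> u \<in> S"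
  shows "S = {A + 1..A + card S}"
proof (cases "S = {}")
  case False
  have fin: "finite S" using sub finite_subset by blast
  have eq: "S = {A + 1..Max S}" using closed[OF Max_in[OF fin False]] sub fin by auto
  have "Max S \<in> S" using fin False by simp
  then have "A + 1 \<le> Max S" using sub by auto
  moreover have "card S = Max S - A" by (subst eq) simp
  ultimately have "A + card S = Max S" by simp
  then show ?thesis using eq by simp
qed simp

lemma up_closed_eq_interval:
  fixes S :: "nat set"
  assumes sub: "S \<subseteq> {A + 1..B}" and closed: "\<And>u v. v \<in> S \<Longrightarrow> u \<in> {v..B} \<Longrightarrow> u \<in> S"
  shows "S = {B - card S + 1..B}"
proof (cases "S = {}")
  case False
  have fin: "finite S" using sub finite_subset by blast
  have eq: "S = {Min S..B}" using closed[OF Min_in[OF fin False]] sub fin by auto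
  have "Min S \<in> S" using fin False by simp
  then have "1 \<le> Min S" "Min S \<le> B" using sub by auto
  moreover have "card S = B + 1 - Min S" by (subst eq) simp
  ultimately have "B - card S + 1 = Min S" by simp
  then show ?thesis using eq by simp
qed simp

lemma card_fiber_of_bij:
  assumes "bij_betw f L M"
  shows "card {v \<in> L. f v = j} = (if j \<in> M then 1 else 0)"
proof (cases "j \<in> M")
  case True
  then obtain v where "v \<in> L" "f v = j" using assms by (auto simp: bij_betw_def)
  then have "{v \<in> L. f v = j} = {v}" using assms by (auto simp: bij_betw_def inj_on_def)
  then show ?thesis using True by simp
next
  case False
  then have "{v \<in> L. f v = j} = {}" using bij_betw_apply[OF assms] by blast
  then show ?thesis using False by (simp only: card.empty if_False)
qed

text \<open>Both outer blocks of the window \<open>{A + 1..B}\<close> contain each color of \<open>M\<close> exactly once. The lemmas in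
  this context compare the window with the inner window that is left without the blocks.\<close>

context
  fixes f :: "nat \<Rightarrow> nat" and A B m :: nat and M :: "nat set"
  assumes left: "bij_betw f {A + 1..A + m} M"
    and right: "bij_betw f {B - m + 1..B} M"
    and room: "A + m \<le> B - m" "m \<le> B"
begin

lemma card_class_peel:
  "card {v \<in> {A + 1..B}. f v = j}
     = card {v \<in> {A + m + 1..B - m}. f v = j} + (if j \<in> M then 2 else 0)"
proof -
  have eq: "{v \<in> {A + 1..B}. f v = j} = {v \<in> {A + 1..A + m}. f v = j}
      \<union> ({v \<in> {A + m + 1..B - m}. f v = j} \<union> {v \<in> {B - m + 1..B}. f v = j})"
    using room by auto
  have "card {v \<in> {A + 1..B}. f v = j} = card {v \<in> {A + 1..A + m}. f v = j}
      + (card {v \<in> {A + m + 1..B - m}. f v = j} + card {v \<in> {B - m + 1..B}. f v = j})"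
    unfolding eq using room by (subst card_Un_disjoint, simp_all, force, subst card_Un_disjoint) auto
  then show ?thesis
    unfolding card_fiber_of_bij[OF left] card_fiber_of_bij[OF right] by (cases "j \<in> M") simp_all
qed

text \<open>Each color of \<open>M\<close> loses one vertex on the left and one on the right, and the two losses cancel.\<close>

lemma imbalance_peel:
  assumes v: "v \<in> {A + m + 1..B - m}"
  shows "imbalance f {A + 1..B} v = imbalance f {A + m + 1..B - m} v"
proof -
  have eq: "{w \<in> {A + 1..B}. w < v \<and> f w = f v} = {w \<in> {A + 1..A + m}. f w = f v}
      \<union> {w \<in> {A + m + 1..B - m}. w < v \<and> f w = f v}"
    "{w \<in> {A + 1..B}. v < w \<and> f w = f v} = {w \<in> {B - m + 1..B}. f w = f v}
      \<union> {w \<in> {A + m + 1..B - m}. v < w \<and> f w = f v}"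
    using v room by auto
  have "card {w \<in> {A + 1..B}. w < v \<and> f w = f v} = card {w \<in> {A + 1..A + m}. f w = f v}
      + card {w \<in> {A + m + 1..B - m}. w < v \<and> f w = f v}"
    "card {w \<in> {A + 1..B}. v < w \<and> f w = f v} = card {w \<in> {B - m + 1..B}. f w = f v}
      + card {w \<in> {A + m + 1..B - m}. v < w \<and> f w = f v}"
    unfolding eq by (subst card_Un_disjoint; auto)+
  then show ?thesis
    unfolding imbalance_def card_fiber_of_bij[OF left] card_fiber_of_bij[OF right] by linarith
qed

text \<open>No color repeats within the left block, so its vertices are the first of their classes; those of
  the right block are the last.\<close>

lemma imbalance_left:
  assumes v: "v \<in> {A + 1..A + m}"
  shows "imbalance f {A + 1..B} v = 1 - int (card {w \<in> {A + 1..B}. f w = f v})"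
proof -
  have none: "{w \<in> {A + 1..B}. w < v \<and> f w = f v} = {}"
    using v inj_onD[OF bij_betw_imp_inj_on[OF left], of _ v] by fastforce
  have "v \<in> {A + 1..B}" using v room by auto
  from imbalance_eq_rank[OF _ this, of f] show ?thesis unfolding none by simp
qed

lemma imbalance_right:
  assumes v: "v \<in> {B - m + 1..B}"
  shows "imbalance f {A + 1..B} v = int (card {w \<in> {A + 1..B}. f w = f v}) - 1"
proof -
  have none: "{w \<in> {A + 1..B}. v < w \<and> f w = f v} = {}"
    using v inj_onD[OF bij_betw_imp_inj_on[OF right], of _ v] by fastforce
  have "v \<in> {A + 1..B}" using v room by auto
  from imbalance_eq_rank[OF _ this, of f] show ?thesis
    unfolding imbalance_def none card.empty by simp
qed

end

text \<open>The invariant of the peeling process, relative to a window \<open>I\<close> of the path: the imbalance and the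
  class sizes are those of the restriction to \<open>I\<close>, so that the predicate applies to
  what is left after some blocks have been removed.\<close>

definition sorted_coloring :: "nat \<Rightarrow> (nat \<Rightarrow> nat) \<Rightarrow> nat set \<Rightarrow> (nat \<Rightarrow> nat) \<Rightarrow> bool" where
  "sorted_coloring k f I r \<longleftrightarrow>
     f \<in> I \<rightarrow> {1..k} \<and> (\<forall>j \<in> {1..k}. card {v \<in> I. f v = j} = r j) \<and>
     mono_on I (imbalance f I)"

lemma le_max_val: "j \<in> {1..k} \<Longrightarrow> r j \<le> max_val k r"
  by (simp add: max_val_def)

lemma max_val_in:
  assumes "k \<ge> 1"
  shows "\<exists>j \<in> {1..k}. r j = max_val k r"
proof -
  have "Max (r ` {1..k}) \<in> r ` {1..k}" using assms by (intro Max_in) auto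
  then obtain j where "j \<in> {1..k}" "Max (r ` {1..k}) = r j" by (elim imageE)
  then show ?thesis by (intro bexI[of _ j]) (simp_all add: max_val_def)
qed

lemma sum_peel:
  assumes "max_val k r > 1"
  shows "(\<Sum>j = 1..k. r j) = (\<Sum>j = 1..k. peel k r j) + 2 * card (max_set k r)"
proof -
  have "(\<Sum>j = 1..k. r j) = (\<Sum>j = 1..k. peel k r j + (if j \<in> max_set k r then 2 else 0))"
    using assms by (intro sum.cong) (auto simp: peel_def max_set_def)
  also have "\<dots> = (\<Sum>j = 1..k. peel k r j) + (\<Sum>j \<in> max_set k r. 2)"
    by (simp add: sum.distrib sum.If_cases Int_def max_set_def conj_commute)
  finally show ?thesis by simp
qed

text \<open>At the two extreme values \<open>p\<close> of the imbalance, the colors that attain \<open>p\<close>, as described in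
  \<open>bij_betw_imbalance_level\<close>, are those of maximal class size.\<close>

lemma max_set_eq_level:
  assumes "max_val k r \<ge> 1" "\<bar>p\<bar> = int (max_val k r) - 1"
  shows "{j \<in> {1..k}. \<bar>p\<bar> < int (r j) \<and> even (int (r j) - 1 - p)} = max_set k r"
proof -
  have "\<bar>p\<bar> < int (r j) \<and> even (int (r j) - 1 - p) \<longleftrightarrow> r j = max_val k r"
    if "j \<in> {1..k}" for j
    using le_max_val[OF that, of r] assms by presburger
  then show ?thesis by (auto simp: max_set_def)
qed

text \<open>One peeling step. From left to right, monotonicity turns the level sets of the least and
  the greatest imbalance into the two outer blocks. From right to left, the blocks restore
  the class sizes and carry the extreme values \<open>1 - q\<close> and \<open>q - 1\<close>, between which all values on the
  inner window lie.\<close>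

lemma sorted_coloring_peel_iff:
  assumes q: "max_val k r > 1" and m: "m = card (max_set k r)"
    and B: "B = A + (\<Sum>j = 1..k. r j)"
  shows "sorted_coloring k f {A + 1..B} r \<longleftrightarrow>
    bij_betw f {A + 1..A + m} (max_set k r) \<and> bij_betw f {B - m + 1..B} (max_set k r) \<and>
    sorted_coloring k f {A + m + 1..B - m} (peel k r)"
    (is "_ \<longleftrightarrow> ?L \<and> ?R \<and> _")
proof -
  let ?I = "{A + 1..B}" and ?N = "{A + m + 1..B - m}" and ?q = "int (max_val k r)"
  have room: "A + m \<le> B - m" "m \<le> B" using sum_peel[OF q] B m by auto
  have split: "v \<in> {A + 1..A + m} \<or> v \<in> ?N \<or> v \<in> {B - m + 1..B}" if "v \<in> ?I" for v
    using that by auto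
  show ?thesis
  proof
    assume good: "sorted_coloring k f ?I r"
    have fK: "f \<in> ?I \<rightarrow> {1..k}" and cnt: "\<And>j. j \<in> {1..k} \<Longrightarrow> card {v \<in> ?I. f v = j} = r j"
      and mono: "\<And>u v. u \<in> ?I \<Longrightarrow> v \<in> ?I \<Longrightarrow> u \<le> v \<Longrightarrow> imbalance f ?I u \<le> imbalance f ?I v"
      using good unfolding sorted_coloring_def mono_on_def by blast+
    have bound: "\<bar>imbalance f ?I v\<bar> \<le> ?q - 1" if "v \<in> ?I" for v
    proof -
      have "f v \<in> {1..k}" using fK that by blast
      then have "card {w \<in> ?I. f w = f v} \<le> max_val k r" using cnt le_max_val[of "f v" k r] by simp
      then show ?thesis using abs_imbalance_less[OF finite_atLeastAtMost that, of f] by linarith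
    qed
    have level: "bij_betw f {v \<in> ?I. imbalance f ?I v = p} (max_set k r)" if "\<bar>p\<bar> = ?q - 1" for p
      using bij_betw_imbalance_level[OF _ fK cnt, of p] max_set_eq_level[of k r p] q that by simp
    have lowest: "bij_betw f {v \<in> ?I. imbalance f ?I v = 1 - ?q} (max_set k r)"
      and highest: "bij_betw f {v \<in> ?I. imbalance f ?I v = ?q - 1} (max_set k r)"
      by (rule level, use q in simp)+
    have "{v \<in> ?I. imbalance f ?I v = 1 - ?q} = {A + 1..A + card {v \<in> ?I. imbalance f ?I v = 1 - ?q}}"
    proof (rule down_closed_eq_interval)
      fix u v assume "v \<in> {v \<in> ?I. imbalance f ?I v = 1 - ?q}" "u \<in> {A + 1..v}"
      then show "u \<in> {v \<in> ?I. imbalance f ?I v = 1 - ?q}" using mono[of u v] bound[of u] by auto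
    qed auto
    then have L: ?L using lowest bij_betw_same_card[OF lowest] m by simp
    have "{v \<in> ?I. imbalance f ?I v = ?q - 1} = {B - card {v \<in> ?I. imbalance f ?I v = ?q - 1} + 1..B}"
    proof (rule up_closed_eq_interval)
      fix u v assume "v \<in> {v \<in> ?I. imbalance f ?I v = ?q - 1}" "u \<in> {v..B}"
      then show "u \<in> {v \<in> ?I. imbalance f ?I v = ?q - 1}" using mono[of v u] bound[of u] by auto
    qed auto
    then have R: ?R using highest bij_betw_same_card[OF highest] m by simp
    have "card {v \<in> ?N. f v = j} = peel k r j" if "j \<in> {1..k}" for j
      using card_class_peel[OF L R room, of j] cnt[OF that] q
      by (auto simp: peel_def max_set_def split: if_splits)
    moreover have "mono_on ?N (imbalance f ?N)"
    proof (rule mono_onI)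
      fix u v assume uv: "u \<in> ?N" "v \<in> ?N" "u \<le> v"
      then show "imbalance f ?N u \<le> imbalance f ?N v"
        using imbalance_peel[OF L R room] mono[of u v] by auto
    qed
    moreover have "f \<in> ?N \<rightarrow> {1..k}"
      by (intro subsetD[OF Pi_anti_mono fK]) auto
    ultimately show "?L \<and> ?R \<and> sorted_coloring k f ?N (peel k r)"
      using L R by (simp add: sorted_coloring_def)
  next
    assume asm: "?L \<and> ?R \<and> sorted_coloring k f ?N (peel k r)"
    then have L: ?L and R: ?R by auto
    have fN: "f \<in> ?N \<rightarrow> {1..k}" and cntN: "\<And>j. j \<in> {1..k} \<Longrightarrow> card {v \<in> ?N. f v = j} = peel k r j"
      and monoN: "\<And>u v. u \<in> ?N \<Longrightarrow> v \<in> ?N \<Longrightarrow> u \<le> v \<Longrightarrow> imbalance f ?N u \<le> imbalance f ?N v"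
      using asm unfolding sorted_coloring_def mono_on_def by blast+
    have fL: "f v \<in> max_set k r" if "v \<in> {A + 1..A + m}" for v
      using bij_betw_apply[OF L that] .
    have fR: "f v \<in> max_set k r" if "v \<in> {B - m + 1..B}" for v
      using bij_betw_apply[OF R that] .
    have fI: "f v \<in> {1..k}" if "v \<in> ?I" for v
      using split[OF that] fL[of v] fR[of v] funcset_mem[OF fN, of v]
      unfolding max_set_def by blast
    have cnt: "card {v \<in> ?I. f v = j} = r j" if "j \<in> {1..k}" for j
      using card_class_peel[OF L R room, of j] cntN[OF that] q
      by (auto simp: peel_def max_set_def split: if_splits)
    have sL: "imbalance f ?I v = 1 - ?q" if "v \<in> {A + 1..A + m}" for v
      using imbalance_left[OF L R room that] cnt[of "f v"] fL[OF that] by (simp add: max_set_def)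
    have sR: "imbalance f ?I v = ?q - 1" if "v \<in> {B - m + 1..B}" for v
      using imbalance_right[OF L R room that] cnt[of "f v"] fR[OF that] by (simp add: max_set_def)
    have bound: "\<bar>imbalance f ?I v\<bar> \<le> ?q - 1" if "v \<in> ?I" for v
      using abs_imbalance_less[OF finite_atLeastAtMost that, of f] cnt[OF fI[OF that]] le_max_val[OF fI[OF that], of r] that
      by simp
    have "mono_on ?I (imbalance f ?I)"
    proof (rule mono_onI)
      fix u v assume uv: "u \<in> ?I" "v \<in> ?I" "u \<le> v"
      consider "u \<in> {A + 1..A + m}" | "v \<in> {B - m + 1..B}" | "u \<in> ?N" "v \<in> ?N"
        using uv room by force
      then show "imbalance f ?I u \<le> imbalance f ?I v"
      proof cases
        case 1
        then show ?thesis using sL[of u] bound[OF uv(2)] by linarith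
      next
        case 2
        then show ?thesis using sR[of v] bound[OF uv(1)] by linarith
      next
        case 3
        then show ?thesis using imbalance_peel[OF L R room] monoN[of u v] uv by simp
      qed
    qed
    then show "sorted_coloring k f ?I r" using fI cnt by (auto simp: sorted_coloring_def)
  qed
qed

text \<open>The last step in the case of remaining class sizes \<open>0\<close> and \<open>1\<close>: every imbalance is \<open>0\<close>, and the left
  and right level sets coincide with the whole window.\<close>

lemma sorted_coloring_last_iff:
  assumes q: "max_val k r = 1" and B: "B = A + (\<Sum>j = 1..k. r j)"
  shows "sorted_coloring k f {A + 1..B} r \<longleftrightarrow> bij_betw f {A + 1..B} (max_set k r)"
proof -
  let ?I = "{A + 1..B}"
  have zero: "imbalance f ?I v = 0" if "v \<in> ?I" "card {w \<in> ?I. f w = f v} \<le> 1" for v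
    using abs_imbalance_less[OF finite_atLeastAtMost that(1), of f] that(2) by linarith
  show ?thesis
  proof
    assume good: "sorted_coloring k f ?I r"
    have fK: "f \<in> ?I \<rightarrow> {1..k}" and cnt: "\<And>j. j \<in> {1..k} \<Longrightarrow> card {v \<in> ?I. f v = j} = r j"
      using good unfolding sorted_coloring_def by blast+
    have "card {w \<in> ?I. f w = f v} \<le> 1" if "v \<in> ?I" for v
      using cnt[OF funcset_mem[OF fK that]] le_max_val[OF funcset_mem[OF fK that], of r] q
      by linarith
    then have all: "{v \<in> ?I. imbalance f ?I v = 0} = ?I" using zero by blast
    have level: "bij_betw f {v \<in> ?I. imbalance f ?I v = 0}
        {j \<in> {1..k}. \<bar>0\<bar> < int (r j) \<and> even (int (r j) - 1 - 0)}"
      using fK cnt by (intro bij_betw_imbalance_level) auto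
    have "{j \<in> {1..k}. \<bar>0\<bar> < int (r j) \<and> even (int (r j) - 1 - 0)} = max_set k r"
      using q by (intro max_set_eq_level) auto
    then show "bij_betw f ?I (max_set k r)" using level unfolding all by simp
  next
    assume bij: "bij_betw f ?I (max_set k r)"
    have fK: "f v \<in> {1..k}" if "v \<in> ?I" for v
      using bij_betw_apply[OF bij that] by (simp add: max_set_def)
    have cnt: "card {v \<in> ?I. f v = j} = r j" if "j \<in> {1..k}" for j
      unfolding card_fiber_of_bij[OF bij] using le_max_val[OF that, of r] q that
      by (auto simp: max_set_def)
    have "imbalance f ?I v = 0" if "v \<in> ?I" for v
      using zero[OF that] card_fiber_of_bij[OF bij, of "f v"] by (simp split: if_splits)
    then have "mono_on ?I (imbalance f ?I)" by (intro mono_onI) simp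
    then show "sorted_coloring k f ?I r" using fK cnt by (simp add: sorted_coloring_def Pi_iff)
  qed
qed


section \<open>Iterated peeling and the family attached to a type\<close>

lemma max_val_le_iff: "k \<ge> 1 \<Longrightarrow> max_val k r \<le> c \<longleftrightarrow> (\<forall>j \<in> {1..k}. r j \<le> c)"
  by (simp add: max_val_def)

lemma peel_le: "peel k r j \<le> r j"
  by (simp add: peel_def)

lemma residual_1: "residual t 1 = (\<lambda>j. t ! (j - 1))"
  by (simp add: residual_def)

lemma residual_Suc: "i \<ge> 1 \<Longrightarrow> residual t (Suc i) = peel (length t) (residual t i)"
  by (cases i) (simp_all add: residual_def)

lemma sum_residual_1: "(\<Sum>j = 1..length t. residual t 1 j) = sum_list t"
proof -
  have "(\<Sum>j = 1..length t. residual t 1 j) = (\<Sum>j = 0..<length t. t ! j)"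
    unfolding residual_1
    by (rule sum.reindex_bij_witness[where i = Suc and j = "\<lambda>j. j - 1"]) auto
  then show ?thesis by (simp add: sum_list_sum_nth)
qed

lemma res_max_antimono:
  assumes "length t \<ge> 1" "1 \<le> i" "i \<le> l"
  shows "res_max t l \<le> res_max t i"
  using assms(3)
proof (induction l rule: dec_induct)
  case (step l)
  have "residual t (Suc l) j \<le> res_max t l" if "j \<in> {1..length t}" for j
    using peel_le[of "length t" "residual t l" j] le_max_val[OF that, of "residual t l"]
      residual_Suc[of l t] step.hyps assms(2) unfolding res_max_def by simp
  then have "res_max t (Suc l) \<le> res_max t l"
    using max_val_le_iff[OF assms(1)] unfolding res_max_def by blast
  then show ?case using step.IH by simp
qed simp

lemma res_max_Suc_eq_0:
  assumes "length t \<ge> 1" "i \<ge> 1" "res_max t i \<le> 1"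
  shows "res_max t (Suc i) = 0"
proof -
  have "residual t (Suc i) j \<le> 0" if "j \<in> {1..length t}" for j
    using le_max_val[OF that, of "residual t i"] assms(3) that
    unfolding residual_Suc[OF assms(2)] res_max_def peel_def max_set_def by auto
  then have "res_max t (Suc i) \<le> 0"
    using max_val_le_iff[OF assms(1)] unfolding res_max_def by blast
  then show ?thesis by simp
qed

text \<open>The sum of the tuple drops at each step until it vanishes. This bounds the indices with a
  positive maximum, so that \<open>last_index\<close> is a genuine maximum.\<close>

lemma residual_sum_bound:
  assumes k: "length t \<ge> 1" and "i \<ge> 1" "res_max t i > 0"
  shows "(\<Sum>j = 1..length t. residual t i j) + i \<le> sum_list t + 1"
  using assms(2,3)
proof (induction i rule: dec_induct)
  case base
  then show ?case using sum_residual_1 by simp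
next
  case (step i)
  have pos: "res_max t i > 0" using res_max_antimono[OF k step.hyps(1), of "Suc i"] step.prems by simp
  obtain j where j: "j \<in> {1..length t}" "residual t i j = res_max t i"
    using max_val_in[OF k] unfolding res_max_def by blast
  then have "peel (length t) (residual t i) j < residual t i j"
    using pos by (auto simp: peel_def max_set_def res_max_def)
  then have "(\<Sum>j = 1..length t. residual t (Suc i) j) < (\<Sum>j = 1..length t. residual t i j)"
    unfolding residual_Suc[OF step.hyps(1)]
    using j(1) peel_le by (intro sum_strict_mono_ex1) auto
  then show ?case using step.IH[OF pos] by simp
qed

text \<open>Before the last index the maximum exceeds \<open>1\<close>, since a maximum of at most \<open>1\<close> is followed
  by the zero tuple. Hence every earlier step removes two blocks.\<close>

lemma last_index_props:
  assumes n: "sum_list t \<ge> 1"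
  shows "last_index t \<ge> 1" "res_max t (last_index t) > 0" "res_max t (Suc (last_index t)) = 0"
    "\<And>i. 1 \<le> i \<Longrightarrow> i < last_index t \<Longrightarrow> res_max t i > 1"
proof -
  have k: "length t \<ge> 1" using n by (cases t) auto
  let ?P = "\<lambda>i. i \<ge> 1 \<and> res_max t i > 0"
  have "res_max t 1 > 0"
  proof (rule ccontr)
    assume "\<not> res_max t 1 > 0"
    then have "\<forall>j \<in> {1..length t}. residual t 1 j = 0"
      using max_val_le_iff[OF k, of "residual t 1" 0] unfolding res_max_def by simp
    then have "(\<Sum>j = 1..length t. residual t 1 j) = 0" by (simp only: sum.neutral)
    then show False using sum_residual_1[of t] n by linarith
  qed
  then have 1: "?P 1" by simp
  have bound: "\<forall>i. ?P i \<longrightarrow> i \<le> sum_list t + 1"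
    using residual_sum_bound[OF k] by (meson add_leD2)
  have P: "?P (last_index t)" unfolding last_index_def by (rule GreatestI_nat[where P = ?P, OF 1]) (use bound in blast)
  then show "last_index t \<ge> 1" "res_max t (last_index t) > 0" by auto
  show "res_max t (Suc (last_index t)) = 0"
  proof (rule ccontr)
    assume "res_max t (Suc (last_index t)) \<noteq> 0"
    then have "?P (Suc (last_index t))" by simp
    then have "Suc (last_index t) \<le> last_index t"
      unfolding last_index_def by (rule Greatest_le_nat[where P = ?P]) (use bound in blast)
    then show False by simp
  qed
  show "res_max t i > 1" if i: "1 \<le> i" "i < last_index t" for i
  proof (rule ccontr)
    assume "\<not> res_max t i > 1"
    then have "res_max t (Suc i) = 0" using res_max_Suc_eq_0[OF k i(1)] by simp
    then show False using res_max_antimono[OF k, of "Suc i" "last_index t"] i P by simp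
  qed
qed

text \<open>The first \<open>l\<close> peeling steps together. The identity for \<open>sum_list t\<close> is the length of the
  remaining window, which each further step relies on.\<close>

lemma sorted_coloring_peel_blocks:
  fixes t :: "nat list"
  defines "S \<equiv> \<lambda>l. \<Sum>j = 1..l. card (res_set t j)"
  assumes "\<And>i. i \<in> {1..l} \<Longrightarrow> res_max t i > 1"
  shows "sum_list t = (\<Sum>j = 1..length t. residual t (Suc l) j) + 2 * S l \<and>
    (sorted_coloring (length t) f {1..sum_list t} (\<lambda>j. t ! (j - 1)) \<longleftrightarrow>
      (\<forall>i \<in> {1..l}. bij_betw f (left_block t i) (res_set t i) \<and>
                     bij_betw f (right_block t i) (res_set t i)) \<and>
      sorted_coloring (length t) f {S l + 1..sum_list t - S l} (residual t (Suc l)))"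
  using assms(2)
proof (induction l)
  case 0
  show ?case using sum_residual_1[of t] residual_1[of t] by (simp add: S_def)
next
  case (Suc l)
  have prev: "\<And>i. i \<in> {1..l} \<Longrightarrow> res_max t i > 1" using Suc.prems by simp
  note sum = conjunct1[OF Suc.IH[OF prev]] and iff = conjunct2[OF Suc.IH[OF prev]]
  have q: "max_val (length t) (residual t (Suc l)) > 1"
    using Suc.prems[of "Suc l"] by (simp add: res_max_def)
  have next_res: "residual t (Suc (Suc l)) = peel (length t) (residual t (Suc l))"
    by (rule residual_Suc) simp
  have SS: "S (Suc l) = S l + card (max_set (length t) (residual t (Suc l)))"
    by (simp add: S_def res_set_def)
  have "sum_list t = (\<Sum>j = 1..length t. residual t (Suc (Suc l)) j) + 2 * S (Suc l)"
    using sum sum_peel[OF q] unfolding next_res SS by simp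
  moreover have "sorted_coloring (length t) f {1..sum_list t} (\<lambda>j. t ! (j - 1)) \<longleftrightarrow>
      (\<forall>i \<in> {1..Suc l}. bij_betw f (left_block t i) (res_set t i) \<and>
                     bij_betw f (right_block t i) (res_set t i)) \<and>
      sorted_coloring (length t) f {S (Suc l) + 1..sum_list t - S (Suc l)} (residual t (Suc (Suc l)))"
  proof -
    have L: "left_block t (Suc l) = {S l + 1..S l + card (max_set (length t) (residual t (Suc l)))}"
      unfolding left_block_def SS[symmetric] by (simp add: S_def atLeastLessThanSuc_atLeastAtMost)
    have R: "right_block t (Suc l) = {sum_list t - S l
        - card (max_set (length t) (residual t (Suc l))) + 1..sum_list t - S l}"
      unfolding right_block_def diff_diff_left SS[symmetric]
      by (simp add: S_def atLeastLessThanSuc_atLeastAtMost)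
    have "sorted_coloring (length t) f {S l + 1..sum_list t - S l} (residual t (Suc l)) \<longleftrightarrow>
      bij_betw f (left_block t (Suc l)) (res_set t (Suc l)) \<and>
      bij_betw f (right_block t (Suc l)) (res_set t (Suc l)) \<and>
      sorted_coloring (length t) f {S (Suc l) + 1..sum_list t - S (Suc l)} (residual t (Suc (Suc l)))"
      using sorted_coloring_peel_iff[OF q refl, of "sum_list t - S l" "S l" f] sum
      unfolding L R res_set_def next_res SS by (simp add: diff_diff_left)
    moreover have "(\<forall>i \<in> {1..Suc l}. Q i) \<longleftrightarrow> (\<forall>i \<in> {1..l}. Q i) \<and> Q (Suc l)" for Q
      by (simp add: atLeastAtMostSuc_conv conj_commute)
    ultimately show ?thesis using iff by (simp only: conj_assoc)
  qed
  ultimately show ?case ..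
qed

text \<open>Apply \<open>sorted_coloring_peel_blocks\<close> until nothing is left, if the last maximum exceeds \<open>1\<close>, or until
  the remaining class sizes are at most \<open>1\<close>, where the definition of the family asks for a left block
  only and \<open>sorted_coloring_last_iff\<close> takes over.\<close>

lemma C_family_iff_sorted_coloring:
  assumes n: "sum_list t \<ge> 1"
  shows "f \<in> C_family t \<longleftrightarrow>
    sorted_coloring (length t) f {1..sum_list t} (\<lambda>j. t ! (j - 1))"
proof -
  let ?k = "length t" and ?l = "last_index t"
  let ?S = "\<lambda>l. \<Sum>j = 1..l. card (res_set t j)"
  let ?blocks = "\<lambda>i. bij_betw f (left_block t i) (res_set t i) \<and>
                     bij_betw f (right_block t i) (res_set t i)"
  let ?good = "sorted_coloring ?k f {1..sum_list t} (\<lambda>j. t ! (j - 1))"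
  have k: "?k \<ge> 1" using n by (cases t) auto
  note last = last_index_props[OF n]
  have Pi: "?good \<Longrightarrow> f \<in> {1..sum_list t} \<rightarrow> {1..?k}" by (simp add: sorted_coloring_def)
  show ?thesis
  proof (cases "res_max t ?l = 1")
    case False
    then have big: "res_max t i > 1" if "i \<in> {1..?l}" for i
      using last(2) last(4)[of i] that False by (cases "i = ?l") auto
    have zero: "residual t (Suc ?l) j = 0" if "j \<in> {1..?k}" for j
      using le_max_val[OF that, of "residual t (Suc ?l)"] last(3) unfolding res_max_def by simp
    then have "sum_list t = 2 * ?S ?l" using conjunct1[OF sorted_coloring_peel_blocks[where l = ?l, OF big]] by simp
    then have "sorted_coloring ?k f {?S ?l + 1..sum_list t - ?S ?l} (residual t (Suc ?l))"
      using zero by (simp add: sorted_coloring_def mono_on_def)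
    then have "?good \<longleftrightarrow> (\<forall>i \<in> {1..?l}. ?blocks i)"
      using conjunct2[OF sorted_coloring_peel_blocks[where l = ?l and f = f, OF big]] by blast
    then show ?thesis
      using Pi False big[of ?l] last(1) unfolding C_family_def by (auto simp: path_graph_def verts_def)
  next
    case True
    obtain l where l: "?l = Suc l" using last(1) by (cases ?l) auto
    have big: "res_max t i > 1" if "i \<in> {1..l}" for i using last(4)[of i] that l by auto
    note sum = conjunct1[OF sorted_coloring_peel_blocks[where l = l, OF big]]
    have q: "max_val ?k (residual t (Suc l)) = 1" using True l by (simp add: res_max_def)
    have small: "residual t (Suc l) j = (if j \<in> res_set t (Suc l) then 1 else 0)" if "j \<in> {1..?k}" for j
      using le_max_val[OF that, of "residual t (Suc l)"] q that
      by (auto simp: res_set_def max_set_def)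
    have "(\<Sum>j = 1..?k. residual t (Suc l) j) = card (res_set t (Suc l))"
    proof -
      have "(\<Sum>j = 1..?k. residual t (Suc l) j) = (\<Sum>j = 1..?k. if j \<in> res_set t (Suc l) then 1 else 0)"
        using small by (intro sum.cong) auto
      also have "\<dots> = card ({1..?k} \<inter> res_set t (Suc l))" by (simp add: sum.If_cases)
      also have "{1..?k} \<inter> res_set t (Suc l) = res_set t (Suc l)"
        by (auto simp: res_set_def max_set_def)
      finally show ?thesis .
    qed
    then have B: "sum_list t - ?S l = ?S l + card (res_set t (Suc l))" using sum by simp
    have block: "left_block t (Suc l) = {?S l + 1..sum_list t - ?S l}"
      unfolding left_block_def B by (simp add: atLeastLessThanSuc_atLeastAtMost)
    have "sorted_coloring ?k f {?S l + 1..sum_list t - ?S l} (residual t (Suc l)) \<longleftrightarrow>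
        bij_betw f (left_block t (Suc l)) (res_set t (Suc l))"
      unfolding block res_set_def[of t "Suc l"]
      using sum by (intro sorted_coloring_last_iff[OF q]) simp
    then have "?good \<longleftrightarrow> (\<forall>i \<in> {1..l}. ?blocks i) \<and> bij_betw f (left_block t ?l) (res_set t ?l)"
      using conjunct2[OF sorted_coloring_peel_blocks[where l = l and f = f, OF big]] l
      by (simp only:)
    then show ?thesis
      using Pi True unfolding C_family_def l
      by (auto simp: path_graph_def verts_def atLeastLessThanSuc_atLeastAtMost)
  qed
qed


section \<open>The Wiener index on a path\<close>

lemma verts_path_graph: "verts (path_graph n) = {1..n}"
  by (simp add: verts_def path_graph_def)

lemma edges_path_graph: "edges (path_graph n) = {{u, Suc u} | u. 1 \<le> u \<and> Suc u \<le> n}"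
  by (auto simp: edges_def path_graph_def)

lemma color_class_path_graph: "color_class (path_graph n) f j = {v \<in> {1..n}. f v = j}"
  by (simp add: color_class_def verts_path_graph)

text \<open>Adjacent vertices differ by one, so a path from \<open>u\<close> cannot rise faster than one unit per edge.\<close>

lemma gdist_path_graph:
  assumes "1 \<le> u" "u < v" "v \<le> n"
  shows "gdist (path_graph n) u v = v - u"
  unfolding gdist_def
proof (rule Least_equality)
  have "is_path (path_graph n) u [u..<Suc v] v"
    using assms by (auto simp: is_path_def verts_path_graph edges_path_graph simp del: upt_Suc)
  then show "\<exists>p. is_path (path_graph n) u p v \<and> v - u = length p - 1"
    using assms by (intro exI[of _ "[u..<Suc v]"]) (simp del: upt_Suc)
next
  fix l assume "\<exists>p. is_path (path_graph n) u p v \<and> l = length p - 1"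
  then obtain p where p: "is_path (path_graph n) u p v" and l: "l = length p - 1" by blast
  have ne: "p \<noteq> []" and hd: "hd p = u" and last: "last p = v"
    and step: "\<And>i. Suc i < length p \<Longrightarrow> {p ! i, p ! Suc i} \<in> edges (path_graph n)"
    using p by (auto simp: is_path_def)
  have "p ! i \<le> u + i" if "i < length p" for i
    using that
  proof (induction i)
    case 0
    then show ?case using hd ne by (simp add: hd_conv_nth)
  next
    case (Suc i)
    have "p ! Suc i \<le> p ! i + 1"
      using step[OF Suc.prems] by (auto simp: edges_path_graph doubleton_eq_iff)
    then show ?case using Suc by simp
  qed
  from this[of "length p - 1"] show "v - u \<le> l" using ne last l by (simp add: last_conv_nth)
qed

text \<open>Sum \<open>v - u\<close> over the pairs \<open>u < v\<close>, and collect the terms belonging to one vertex.\<close>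

lemma wiener_set_path_graph:
  assumes A: "A \<subseteq> {1..n}"
  shows "int (wiener_set (path_graph n) A)
    = (\<Sum>v \<in> A. int v * (int (card {u \<in> A. u < v}) - int (card {u \<in> A. v < u})))"
proof -
  have fin: "finite A" using A finite_subset by blast
  have D: "{(u, v). u \<in> A \<and> v \<in> A \<and> u < v} = (SIGMA u:A. {v \<in> A. u < v})" by auto
  have "int (wiener_set (path_graph n) A) = (\<Sum>(u, v) \<in> (SIGMA u:A. {v \<in> A. u < v}). int v - int u)"
    unfolding wiener_set_def D of_nat_sum
    using A by (intro sum.cong) (auto simp: gdist_path_graph subset_iff)
  also have "\<dots> = (\<Sum>u \<in> A. \<Sum>v \<in> {v \<in> A. u < v}. int v - int u)"
    using fin by (subst sum.Sigma) auto
  also have "\<dots> = (\<Sum>u \<in> A. \<Sum>v \<in> {v \<in> A. u < v}. int v) - (\<Sum>u \<in> A. \<Sum>v \<in> {v \<in> A. u < v}. int u)"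
    by (simp add: sum_subtractf)
  also have "(\<Sum>u \<in> A. \<Sum>v \<in> {v \<in> A. u < v}. int v) = (\<Sum>v \<in> A. \<Sum>u \<in> {u \<in> A. u < v}. int v)"
    using fin by (intro sum.swap_restrict) auto
  finally show ?thesis by (simp add: sum_subtractf algebra_simps)
qed

lemma wiener_path_graph:
  assumes f: "f \<in> {1..n} \<rightarrow> {1..k}"
  shows "int (wiener (path_graph n) k f) = (\<Sum>v = 1..n. int v * imbalance f {1..n} v)"
proof -
  have "int (wiener (path_graph n) k f)
      = (\<Sum>j = 1..k. int (wiener_set (path_graph n) {v \<in> {1..n}. f v = j}))"
    by (simp add: wiener_def color_class_path_graph)
  also have "\<dots> = (\<Sum>j = 1..k. \<Sum>v \<in> {v \<in> {1..n}. f v = j}. int v * imbalance f {1..n} v)"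
  proof (rule sum.cong[OF refl])
    fix j
    let ?A = "{v \<in> {1..n}. f v = j}"
    have "int (wiener_set (path_graph n) ?A)
        = (\<Sum>v \<in> ?A. int v * (int (card {u \<in> ?A. u < v}) - int (card {u \<in> ?A. v < u})))"
      by (rule wiener_set_path_graph) auto
    also have "\<dots> = (\<Sum>v \<in> ?A. int v * imbalance f {1..n} v)"
    proof (rule sum.cong[OF refl])
      fix v assume "v \<in> ?A"
      then have "{u \<in> ?A. u < v} = {w \<in> {1..n}. w < v \<and> f w = f v}"
        "{u \<in> ?A. v < u} = {w \<in> {1..n}. v < w \<and> f w = f v}" by auto
      then show "int v * (int (card {u \<in> ?A. u < v}) - int (card {u \<in> ?A. v < u}))
          = int v * imbalance f {1..n} v"
        unfolding imbalance_def by (simp only:)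
    qed
    finally show "int (wiener_set (path_graph n) ?A) = (\<Sum>v \<in> ?A. int v * imbalance f {1..n} v)" .
  qed
  also have "\<dots> = (\<Sum>v = 1..n. int v * imbalance f {1..n} v)"
    using f by (intro sum.group) auto
  finally show ?thesis .
qed


section \<open>The rearrangement inequality and the type\<close>

text \<open>Abel summation: \<open>v\<close> counts the tails \<open>{u..n}\<close> that contain \<open>v\<close>. It reduces the rearrangement
  inequality to a comparison of tail sums.\<close>

lemma sum_weighted_eq_tail_sums:
  fixes s :: "nat \<Rightarrow> int"
  shows "(\<Sum>v = 1..n. int v * s v) = (\<Sum>u = 1..n. \<Sum>v \<in> {v \<in> {1..n}. u \<le> v}. s v)"
proof -
  have "(\<Sum>u = 1..n. \<Sum>v \<in> {v \<in> {1..n}. u \<le> v}. s v) = (\<Sum>v = 1..n. \<Sum>u \<in> {u \<in> {1..n}. u \<le> v}. s v)"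
    by (intro sum.swap_restrict) auto
  also have "\<dots> = (\<Sum>v = 1..n. int v * s v)"
  proof (rule sum.cong[OF refl])
    fix v assume "v \<in> {1..n}"
    then have "{u \<in> {1..n}. u \<le> v} = {1..v}" by auto
    then show "(\<Sum>u \<in> {u \<in> {1..n}. u \<le> v}. s v) = int v * s v" by simp
  qed
  finally show ?thesis by simp
qed

text \<open>The rearrangement inequality. For the tail starting at \<open>u\<close> take the threshold \<open>c = s u\<close>. The tail sum
  of \<open>s' - c\<close> is at most the sum of the positive parts of \<open>s' - c\<close> over all positions. That quantity
  depends only on the multiset of values, and for the sorted \<open>s\<close> it equals the tail sum of \<open>s - c\<close>.\<close>

lemma sum_weighted_le_sorted:
  fixes s s' :: "nat \<Rightarrow> int"
  assumes mono: "mono_on {1..n} s"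
    and same: "image_mset s' (mset_set {1..n}) = image_mset s (mset_set {1..n})"
  shows "(\<Sum>v = 1..n. int v * s' v) \<le> (\<Sum>v = 1..n. int v * s v)"
  unfolding sum_weighted_eq_tail_sums
proof (rule sum_mono)
  fix u assume u: "u \<in> {1..n}"
  let ?T = "{v \<in> {1..n}. u \<le> v}" and ?c = "s u"
  have "(\<Sum>v \<in> ?T. s' v - ?c) \<le> (\<Sum>v \<in> ?T. max 0 (s' v - ?c))"
    by (intro sum_mono) simp
  also have "\<dots> \<le> (\<Sum>v = 1..n. max 0 (s' v - ?c))"
    by (intro sum_mono2) auto
  also have "\<dots> = (\<Sum>x \<in># image_mset s' (mset_set {1..n}). max 0 (x - ?c))"
    by (simp add: sum_unfold_sum_mset image_mset.compositionality comp_def)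
  also have "\<dots> = (\<Sum>v = 1..n. max 0 (s v - ?c))"
    unfolding same by (simp add: sum_unfold_sum_mset image_mset.compositionality comp_def)
  also have "\<dots> = (\<Sum>v \<in> ?T. s v - ?c)"
  proof (rule sum.mono_neutral_cong_right)
    show "\<forall>v \<in> {1..n} - ?T. max 0 (s v - ?c) = 0"
    proof
      fix v assume "v \<in> {1..n} - ?T"
      then have "s v \<le> s u" using mono_onD[OF mono, of v u] u by auto
      then show "max 0 (s v - ?c) = 0" by simp
    qed
    show "max 0 (s v - ?c) = s v - ?c" if "v \<in> ?T" for v
      using mono_onD[OF mono, of u v] u that by auto
  qed auto
  finally show "sum s' ?T \<le> sum s ?T" by (simp add: sum_subtractf)
qed

lemma mset_color_type:
  "mset (color_type (path_graph n) k f) = image_mset (\<lambda>j. card {v \<in> {1..n}. f v = j}) (mset_set {1..k})"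
proof -
  have "{1..<k + 1} = {1..k}" by auto
  then show ?thesis
    unfolding color_type_def mset_sort mset_map mset_upt color_class_path_graph by simp
qed

lemma length_color_type: "length (color_type G k f) = k"
  by (simp add: color_type_def)

lemma image_mset_nth: "image_mset (\<lambda>j. t ! (j - 1)) (mset_set {1..length t}) = mset t"
proof -
  have "map (\<lambda>j. t ! (j - 1)) [1..<length t + 1] = t"
    by (rule nth_equalityI) (auto simp del: upt_Suc)
  moreover have "{1..<length t + 1} = {1..length t}" by auto
  ultimately show ?thesis by (metis mset_map mset_upt)
qed

text \<open>By \<open>bij_betw_imbalance_level\<close>, how often a value occurs can be read off from the multiset of class
  sizes.\<close>

lemma image_mset_imbalance_eq:
  assumes f: "f \<in> {1..n} \<rightarrow> {1..k}" and f': "f' \<in> {1..n} \<rightarrow> {1..k}"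
    and type: "color_type (path_graph n) k f' = color_type (path_graph n) k f"
  shows "image_mset (imbalance f' {1..n}) (mset_set {1..n})
    = image_mset (imbalance f {1..n}) (mset_set {1..n})"
proof (rule multiset_eqI)
  fix p
  have count: "count (image_mset (imbalance g {1..n}) (mset_set {1..n})) p
      = size (filter_mset (\<lambda>c. \<bar>p\<bar> < int c \<and> even (int c - 1 - p)) (mset (color_type (path_graph n) k g)))"
    if "g \<in> {1..n} \<rightarrow> {1..k}" for g
  proof -
    let ?c = "\<lambda>j. card {v \<in> {1..n}. g v = j}"
    have "count (image_mset (imbalance g {1..n}) (mset_set {1..n})) p
        = card {v \<in> {1..n}. imbalance g {1..n} v = p}"
      by (simp add: count_image_mset_eq_card_vimage)
    also have "\<dots> = card {j \<in> {1..k}. \<bar>p\<bar> < int (?c j) \<and> even (int (?c j) - 1 - p)}"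
      using that by (intro bij_betw_same_card[OF bij_betw_imbalance_level]) auto
    also have "\<dots> = size (filter_mset (\<lambda>c. \<bar>p\<bar> < int c \<and> even (int c - 1 - p)) (image_mset ?c (mset_set {1..k})))"
      by (simp add: filter_mset_image_mset filter_mset_mset_set)
    finally show ?thesis unfolding mset_color_type .
  qed
  show "count (image_mset (imbalance f' {1..n}) (mset_set {1..n})) p
      = count (image_mset (imbalance f {1..n}) (mset_set {1..n})) p"
    unfolding count[OF f] count[OF f'] type ..
qed


section \<open>Swaps of adjacent vertices and maximizers\<close>

lemma swap_colors_eq: "swap_colors u v f = f \<circ> transpose u v"
  by (auto simp: swap_colors_def transpose_def)

lemma card_class_permute:
  assumes "p permutes I"
  shows "card {v \<in> I. (f \<circ> p) v = j} = card {v \<in> I. f v = j}"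
proof (rule bij_betw_same_card[of p], rule bij_betwI')
  fix v assume "v \<in> {v \<in> I. f v = j}"
  then show "\<exists>u \<in> {v \<in> I. (f \<circ> p) v = j}. v = p u"
    using assms by (intro bexI[of _ "inv p v"]) (auto simp: permutes_inverses permutes_in_image permutes_inv)
qed (use assms in \<open>auto simp: permutes_in_image permutes_inj inj_eq\<close>)

text \<open>The transposition \<open>\<tau>\<close> reverses the order of the pair \<open>u\<close>, \<open>u + 1\<close> only. As these two have different
  colors, \<open>\<tau>\<close> preserves the order within each color class and transports the imbalance.\<close>

lemma imbalance_swap:
  assumes u: "u \<in> I" "Suc u \<in> I" and neq: "f u \<noteq> f (Suc u)"
  shows "imbalance (swap_colors u (Suc u) f) I v = imbalance f I (transpose u (Suc u) v)"
proof -
  let ?\<tau> = "transpose u (Suc u)"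
  have inv: "?\<tau> (?\<tau> x) = x" for x by simp
  have mem: "?\<tau> x \<in> I \<longleftrightarrow> x \<in> I" for x using u by (auto simp: transpose_def)
  have less: "?\<tau> x < ?\<tau> y \<longleftrightarrow> x < y" if "f (?\<tau> x) = f (?\<tau> y)" for x y
    using that neq by (auto simp: transpose_def split: if_splits)
  have "card {w \<in> I. w < v \<and> f (?\<tau> w) = f (?\<tau> v)} = card {w \<in> I. w < ?\<tau> v \<and> f w = f (?\<tau> v)}"
    by (rule bij_betw_same_card[of ?\<tau>], rule bij_betw_byWitness[where f' = ?\<tau>])
      (use less mem less[of "?\<tau> _" v] in auto)
  moreover have "card {w \<in> I. v < w \<and> f (?\<tau> w) = f (?\<tau> v)} = card {w \<in> I. ?\<tau> v < w \<and> f w = f (?\<tau> v)}"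
    by (rule bij_betw_same_card[of ?\<tau>], rule bij_betw_byWitness[where f' = ?\<tau>])
      (use less mem less[of v "?\<tau> _"] in auto)
  ultimately show ?thesis by (simp add: imbalance_def swap_colors_eq)
qed

text \<open>In \<open>W(f) = (\<Sum>v. v * s(v))\<close> the swap permutes the values of \<open>s\<close>. After reindexing, only the
  positions \<open>u\<close> and \<open>u + 1\<close> contribute to the difference.\<close>

lemma wiener_swap:
  assumes f: "f \<in> {1..n} \<rightarrow> {1..k}" and u: "1 \<le> u" "Suc u \<le> n" and neq: "f u \<noteq> f (Suc u)"
  shows "int (wiener (path_graph n) k f) - int (wiener (path_graph n) k (swap_colors u (Suc u) f))
    = imbalance f {1..n} (Suc u) - imbalance f {1..n} u"
proof -
  let ?\<tau> = "transpose u (Suc u)" and ?s = "imbalance f {1..n}"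
  have perm: "?\<tau> permutes {1..n}" using u by (intro permutes_swap_id) auto
  have f': "swap_colors u (Suc u) f \<in> {1..n} \<rightarrow> {1..k}"
    unfolding swap_colors_eq using f permutes_in_image[OF perm] by fastforce
  have "int (wiener (path_graph n) k (swap_colors u (Suc u) f)) = (\<Sum>v = 1..n. int v * ?s (?\<tau> v))"
    unfolding wiener_path_graph[OF f'] using u neq by (simp add: imbalance_swap)
  also have "\<dots> = (\<Sum>v = 1..n. int (?\<tau> v) * ?s v)"
    by (subst sum.permute[OF perm]) (simp add: comp_def)
  finally have "int (wiener (path_graph n) k f) - int (wiener (path_graph n) k (swap_colors u (Suc u) f))
      = (\<Sum>v = 1..n. (int v - int (?\<tau> v)) * ?s v)"
    unfolding wiener_path_graph[OF f] by (simp add: sum_subtractf left_diff_distrib)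
  also have "\<dots> = (\<Sum>v \<in> {u, Suc u}. (int v - int (?\<tau> v)) * ?s v)"
    using u by (intro sum.mono_neutral_right) (auto simp: transpose_def)
  finally show ?thesis by simp
qed

lemma imbalance_comp_inj: "inj p \<Longrightarrow> imbalance (p \<circ> f) I = imbalance f I"
  by (rule ext) (simp add: imbalance_def inj_eq)

lemma mono_imbalance_of_local_weak_maximizer:
  assumes loc: "local_weak_maximizer (path_graph n) k f"
  shows "mono_on {1..n} (imbalance f {1..n})"
proof -
  have f: "f \<in> {1..n} \<rightarrow> {1..k}"
    using loc by (auto simp: local_weak_maximizer_def surj_coloring_def verts_path_graph)
  have adjacent: "imbalance f {1..n} u \<le> imbalance f {1..n} (Suc u)" if u: "1 \<le> u" "Suc u \<le> n" for u
  proof (cases "f u = f (Suc u)")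
    case True
    then show ?thesis using imbalance_less_of_less[of "{1..n}" u "Suc u" f] u by simp
  next
    case False
    have "{u, Suc u} \<in> edges (path_graph n)" using u by (auto simp: edges_path_graph)
    then have "wiener (path_graph n) k (swap_colors u (Suc u) f) \<le> wiener (path_graph n) k f"
      using loc by (auto simp: local_weak_maximizer_def)
    then show ?thesis using wiener_swap[OF f u False] by linarith
  qed
  show ?thesis
  proof (rule mono_onI)
    fix u v assume uv: "u \<in> {1..n}" "v \<in> {1..n}" "u \<le> v"
    from uv(3,2) show "imbalance f {1..n} u \<le> imbalance f {1..n} v"
    proof (induction v rule: dec_induct)
      case (step v)
      then show ?case using adjacent[of v] uv(1) by force
    qed simp
  qed
qed

lemma weak_maximizer_of_mono_imbalance:
  assumes surj: "surj_coloring (path_graph n) k f"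
    and mono: "mono_on {1..n} (imbalance f {1..n})"
  shows "weak_maximizer (path_graph n) k f"
  unfolding weak_maximizer_def
proof (intro conjI allI impI surj)
  have f: "f \<in> {1..n} \<rightarrow> {1..k}" using surj by (auto simp: surj_coloring_def verts_path_graph)
  fix f' assume asm: "surj_coloring (path_graph n) k f' \<and>
    color_type (path_graph n) k f' = color_type (path_graph n) k f"
  then have f': "f' \<in> {1..n} \<rightarrow> {1..k}" by (auto simp: surj_coloring_def verts_path_graph)
  have "int (wiener (path_graph n) k f') \<le> int (wiener (path_graph n) k f)"
    unfolding wiener_path_graph[OF f] wiener_path_graph[OF f']
    using asm by (intro sum_weighted_le_sorted mono image_mset_imbalance_eq[OF f f']) auto
  then show "wiener (path_graph n) k f' \<le> wiener (path_graph n) k f" by simp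
qed

lemma local_weak_maximizer_of_weak_maximizer:
  assumes "weak_maximizer (path_graph n) k f"
  shows "local_weak_maximizer (path_graph n) k f"
  unfolding local_weak_maximizer_def
proof (intro conjI allI impI)
  show surj: "surj_coloring (path_graph n) k f" using assms by (simp add: weak_maximizer_def)
  fix u v assume "{u, v} \<in> edges (path_graph n)"
  then have "u \<in> {1..n}" "v \<in> {1..n}" by (auto simp: edges_path_graph doubleton_eq_iff)
  then have perm: "transpose u v permutes {1..n}" by (intro permutes_swap_id)
  have "surj_coloring (path_graph n) k (swap_colors u v f)"
    using surj permutes_image[OF perm]
    unfolding surj_coloring_def verts_path_graph swap_colors_eq by (metis image_comp)
  moreover have "color_type (path_graph n) k (swap_colors u v f) = color_type (path_graph n) k f"
    unfolding color_type_def color_class_path_graph swap_colors_eq card_class_permute[OF perm] ..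
  ultimately show "wiener (path_graph n) k (swap_colors u v f) \<le> wiener (path_graph n) k f"
    using assms by (simp add: weak_maximizer_def)
qed

theorem theorem3p6:
  fixes n k :: nat and g :: "nat \<Rightarrow> nat" and t :: "nat list"
  assumes "n \<ge> 1" and "k \<ge> 2"
    and "surj_coloring (path_graph n) k g"
    and "t = color_type (path_graph n) k g"
  shows "(weak_maximizer (path_graph n) k g \<longleftrightarrow> local_weak_maximizer (path_graph n) k g) \<and>
    (local_weak_maximizer (path_graph n) k g \<longleftrightarrow>
       (\<exists>\<pi>. \<pi> permutes {1..k} \<and> \<pi> \<circ> g \<in> C_family t)) \<and>
    ((\<forall>i \<in> {1..k}. card (color_class (path_graph n) g i) = t ! (i - 1)) \<longrightarrow>
       (local_weak_maximizer (path_graph n) k g \<longleftrightarrow> g \<in> C_family t))"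
proof -
  let ?G = "path_graph n" and ?c = "\<lambda>j. card {v \<in> {1..n}. g v = j}"
  have g: "g \<in> {1..n} \<rightarrow> {1..k}" using assms(3) by (auto simp: surj_coloring_def verts_path_graph)
  have len: "length t = k" using assms(4) length_color_type by simp
  have mset_t: "mset t = image_mset ?c (mset_set {1..k})" using assms(4) mset_color_type by simp
  \<comment> \<open>the classes partition the path\<close>
  have "sum_list t = (\<Sum>j = 1..k. ?c j)"
    by (metis mset_t sum_mset_sum_list sum_unfold_sum_mset)
  also have "\<dots> = (\<Sum>j = 1..k. \<Sum>v \<in> {v \<in> {1..n}. g v = j}. 1)" by simp
  also have "\<dots> = (\<Sum>v = 1..n. 1)" using g by (intro sum.group) auto
  finally have sum: "sum_list t = n" by simp
  have C_iff: "f \<in> C_family t \<longleftrightarrow> sorted_coloring k f {1..n} (\<lambda>j. t ! (j - 1))" for f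
    using C_family_iff_sorted_coloring[of t f] sum len assms(1) by simp
  have mono_iff: "local_weak_maximizer ?G k g \<longleftrightarrow> mono_on {1..n} (imbalance g {1..n})"
    using mono_imbalance_of_local_weak_maximizer local_weak_maximizer_of_weak_maximizer
      weak_maximizer_of_mono_imbalance[OF assms(3)] by blast
  have weak_iff: "weak_maximizer ?G k g \<longleftrightarrow> local_weak_maximizer ?G k g"
    using mono_iff local_weak_maximizer_of_weak_maximizer
      weak_maximizer_of_mono_imbalance[OF assms(3)] by blast
  have perm_iff: "local_weak_maximizer ?G k g \<longleftrightarrow> (\<exists>\<pi>. \<pi> permutes {1..k} \<and> \<pi> \<circ> g \<in> C_family t)"
  proof
    assume "local_weak_maximizer ?G k g"
    then have mono: "mono_on {1..n} (imbalance g {1..n})" using mono_iff by blast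
    \<comment> \<open>the type is the sorted list of class sizes, so some renaming of the colors sorts the classes\<close>
    have "image_mset ?c (mset_set {1..k}) = image_mset (\<lambda>j. t ! (j - 1)) (mset_set {1..k})"
      using mset_t image_mset_nth[of t] len by simp
    then obtain \<pi> where \<pi>: "\<pi> permutes {1..k}" "\<forall>j \<in> {1..k}. ?c j = t ! (\<pi> j - 1)"
      by (rule image_mset_eq_implies_permutes[OF finite_atLeastAtMost])
    have "card {v \<in> {1..n}. (\<pi> \<circ> g) v = j} = t ! (j - 1)" if "j \<in> {1..k}" for j
    proof -
      have "inv \<pi> j \<in> {1..k}" using that permutes_in_image[OF permutes_inv[OF \<pi>(1)]] by blast
      moreover have "{v \<in> {1..n}. (\<pi> \<circ> g) v = j} = {v \<in> {1..n}. g v = inv \<pi> j}"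
        by (auto simp: permutes_inverses[OF \<pi>(1)])
      ultimately show ?thesis using \<pi> permutes_inverses(1)[OF \<pi>(1)] by simp
    qed
    moreover have "\<pi> \<circ> g \<in> {1..n} \<rightarrow> {1..k}" using g permutes_in_image[OF \<pi>(1)] by fastforce
    moreover have "mono_on {1..n} (imbalance (\<pi> \<circ> g) {1..n})"
      using mono imbalance_comp_inj[OF permutes_inj[OF \<pi>(1)]] by simp
    ultimately show "\<exists>\<pi>. \<pi> permutes {1..k} \<and> \<pi> \<circ> g \<in> C_family t"
      using \<pi>(1) unfolding C_iff sorted_coloring_def by blast
  next
    assume "\<exists>\<pi>. \<pi> permutes {1..k} \<and> \<pi> \<circ> g \<in> C_family t"
    then obtain \<pi> where \<pi>: "\<pi> permutes {1..k}" "\<pi> \<circ> g \<in> C_family t" by blast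
    then show "local_weak_maximizer ?G k g"
      unfolding mono_iff C_iff sorted_coloring_def imbalance_comp_inj[OF permutes_inj[OF \<pi>(1)]]
      by blast
  qed
  have "local_weak_maximizer ?G k g \<longleftrightarrow> g \<in> C_family t"
    if "\<forall>i \<in> {1..k}. card (color_class ?G g i) = t ! (i - 1)"
    using that g unfolding mono_iff C_iff sorted_coloring_def color_class_path_graph by blast
  then show ?thesis using weak_iff perm_iff by blast
qed

end
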